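(* Let $S\subset\mathbb{Z}^2$ be a finite integrally convex set. Let $A\subset S$ and $B=S\setminus A$, with $A$ and $B$ both nonempty. Then Condition H (separation by a sequence of affine hyperplanes) and Condition P (parallelogram condition) for the pair $(A,B)$ are equivalent.
   Context: A set $S\subset\mathbb{Z}^d$ is integrally convex if for every $x\in\mathbb{R}^d$, $x\in\operatorname{conv}(S)$ implies $x\in\operatorname{conv}(S\cap N(x))$, where $N(x)=\{y\in\mathbb{Z}^d : |x_i-y_i|<1 \text{ for } i=1,\dots,d\}$ and $\operatorname{conv}$ denotes the convex hull in $\mathbb{R}^d$. Let $A,B\subset\mathbb{Z}^d$ be nonempty disjoint sets and $S=A\cup B$ (here $d=2$). Separation in an affine subspace. Let $L\subset\mathbb{R}^d$ be an affine subspace of dimension $l$. A hyperplane in $L$ is an affine subspace $P\subset L$ of dimension $l-1$. $P$ separates $A$ and $B$ in $L$ if there exist two disjoint connected components $R^+$ and $R^-$ of $L\setminus P$ such that $R^+\cup R^-=L\setminus P$, $R^+\cap S\subset A$ and $R^-\cap S\subset B$. Condition H. There exist $k$ with $0\le k\le d$ and affine subspaces $H_k\subset H_{k+1}\subset\cdots\subset H_d=\mathbb{R}^d$ with $\dim H_i=i$ such that (1) $H_k\cap S\subset A$ or $H_k\cap S\subset B$, and (2) for every $i$ with $k+1\le i\le d$, $H_{i-1}$ separates $A$ and $B$ in $H_i$. Condition P (the 2-parallelogram condition). For $k'\in\{1,2\}$, all $a_1,\dots,a_{k'}\in A$ and all $b_1,\dots,b_{k'}\in B$ (repetitions allowed),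 $\sum_{i=1}^{k'}a_i\ne\sum_{i=1}^{k'}b_i$. *)

theory Defs
  imports "HOL-Analysis.Analysis"
begin

text \<open>The lattice of integer points is regarded as a subset of the ambient Euclidean space, so
  that convex hulls and affine subspaces apply to it directly. The index type plays the role of
  the dimension, which is its cardinality.\<close>

definition int_lattice :: "(real ^ 'n) set" where
  "int_lattice = {x. \<forall>i. x $ i \<in> \<int>}"

definition int_nbhd :: "real ^ 'n \<Rightarrow> (real ^ 'n) set" where
  "int_nbhd x = {y \<in> int_lattice. \<forall>i. \<bar>x $ i - y $ i\<bar> < 1}"

definition integrally_convex :: "(real ^ 'n) set \<Rightarrow> bool" where
  "integrally_convex S \<longleftrightarrow>
     S \<subseteq> int_lattice \<and>
     (\<forall>x. x \<in> convex hull S \<longrightarrow> x \<in> convex hull (S \<inter> int_nbhd x))"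

definition hyperplane_in :: "(real ^ 'n) set \<Rightarrow> (real ^ 'n) set \<Rightarrow> bool" where
  "hyperplane_in L P \<longleftrightarrow> affine P \<and> P \<subseteq> L \<and> aff_dim P = aff_dim L - 1"

definition separates_in ::
  "(real ^ 'n) set \<Rightarrow> (real ^ 'n) set \<Rightarrow> (real ^ 'n) set \<Rightarrow> (real ^ 'n) set \<Rightarrow> bool" where
  "separates_in L P A B \<longleftrightarrow>
     affine L \<and> hyperplane_in L P \<and>
     (\<exists>Rp Rm. Rp \<in> components (L - P) \<and> Rm \<in> components (L - P) \<and> Rp \<inter> Rm = {} \<and>
        Rp \<union> Rm = L - P \<and> Rp \<inter> (A \<union> B) \<subseteq> A \<and> Rm \<inter> (A \<union> B) \<subseteq> B)"

text \<open>Only the members \<open>H k, \<dots>, H d\<close> of the sequence are constrained. Requiring the affine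
  dimension to be a natural number excludes the empty set, for which it is \<open>-1\<close>.\<close>

definition condition_H :: "(real ^ 'n) set \<Rightarrow> (real ^ 'n) set \<Rightarrow> bool" where
  "condition_H A B \<longleftrightarrow>
     (\<exists>k \<le> CARD('n). \<exists>H :: nat \<Rightarrow> (real ^ 'n) set.
        (\<forall>i \<in> {k..CARD('n)}. affine (H i) \<and> aff_dim (H i) = int i) \<and>
        (\<forall>i \<in> {k..<CARD('n)}. H i \<subseteq> H (Suc i)) \<and>
        H CARD('n) = UNIV \<and>
        (H k \<inter> (A \<union> B) \<subseteq> A \<or> H k \<inter> (A \<union> B) \<subseteq> B) \<and>
        (\<forall>i \<in> {k + 1..CARD('n)}. separates_in (H i) (H (i - 1)) A B))"

definition parallelogram_condition ::
  "nat \<Rightarrow> (real ^ 'n) set \<Rightarrow> (real ^ 'n) set \<Rightarrow> bool" where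
  "parallelogram_condition m A B \<longleftrightarrow>
     (\<forall>k \<in> {1..m}. \<forall>a b :: nat \<Rightarrow> real ^ 'n.
        (\<forall>i \<in> {1..k}. a i \<in> A) \<and> (\<forall>i \<in> {1..k}. b i \<in> B) \<longrightarrow>
        (\<Sum>i = 1..k. a i) \<noteq> (\<Sum>i = 1..k. b i))"

end

theory Submission
  imports Defs
begin

text \<open>For a flag, a separating functional at each level forces all points of an equality
  \<open>a1 + \<dots> + ak = b1 + \<dots> + bk\<close> into the next smaller subspace, finally into \<open>H k\<close>, which meets only
  one of \<open>A\<close> and \<open>B\<close>.

  Conversely it suffices that the convex hulls of \<open>A\<close> and \<open>B\<close> are disjoint, since then a hyperplane
  avoiding \<open>S\<close> separates them. If they meet in the plane, then by Caratheodory either two segments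
  \<open>[a, a']\<close> and \<open>[b, b']\<close> meet, or a point of one colour lies in a triangle of the other colour.

  Meeting segments: suppose that, of the four endpoints, \<open>a\<close> has relatively the smallest distance
  to the common point and that \<open>b'\<close> is at least as close to it as \<open>b\<close>. Then \<open>p = b + b' - a\<close> is a
  lattice point in the hull of \<open>{b, b', a'}\<close>, hence in \<open>S\<close>, and the parallelogram condition puts it
  into \<open>B\<close>; now \<open>[p, b']\<close> still meets \<open>[a, a']\<close> and the quadrilateral is smaller.

  Triangle: since segments never meet, no point of \<open>A\<close> can leave the triangle, so \<open>A\<close> lies in the
  interior of the hull of \<open>S\<close>. Integral convexity then puts all axis neighbours of points of \<open>A\<close>
  into \<open>S\<close>, and extreme points of \<open>A\<close> in two opposite axis directions give a parallelogram.\<close>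

section \<open>Separation by a flag implies the parallelogram condition\<close>

text \<open>An affine set is an intersection of full hyperplanes. One of these misses a chosen point
  of \<open>L\<close> outside \<open>P\<close>, so it cuts \<open>L\<close> in codimension one, and
  equal dimension forces the cut to be \<open>P\<close>.\<close>

lemma hyperplane_in_eq_Int:
  fixes L P :: "(real ^ 'n) set"
  assumes "affine L" "hyperplane_in L P" "P \<noteq> {}"
  obtains n c where "P = L \<inter> {x. n \<bullet> x = c}"
proof -
  have P: "affine P" "P \<subseteq> L" "aff_dim P = aff_dim L - 1"
    using assms(2) by (auto simp: hyperplane_in_def)
  then have "P \<noteq> L" by auto
  then obtain q where q: "q \<in> L" "q \<notin> P" using P(2) by blast
  obtain F where F: "affine hull P = \<Inter>F"
      "\<And>h. h \<in> F \<Longrightarrow> \<exists>a b. a \<noteq> 0 \<and> h = {x. a \<bullet> x = b}"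
    using affine_hull_finite_intersection_hyperplanes[of P] by metis
  have "\<Inter>F = P" using F(1) hull_same[of affine P] P(1) by simp
  then obtain h where h: "h \<in> F" "q \<notin> h" "P \<subseteq> h" using q by blast
  then obtain n c where nc: "h = {x. n \<bullet> x = c}" using F(2) by blast
  have sub: "P \<subseteq> L \<inter> {x. n \<bullet> x = c}" using P(2) h(3) nc by blast
  have "aff_dim (L \<inter> {x. n \<bullet> x = c}) = aff_dim L - 1"
    using aff_dim_affine_Int_hyperplane[OF assms(1), of n c] sub assms(3) q h(2) nc by auto
  then have "P = L \<inter> {x. n \<bullet> x = c}"
    using affine_dim_equal[OF P(1) _ assms(3) sub] assms(1) P(3)
    by (simp add: affine_Int affine_hyperplane)
  then show thesis by (rule that)
qed

lemma connected_avoiding_hyperplane: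
  fixes n :: "'a :: euclidean_space"
  assumes "connected C" "\<forall>x\<in>C. n \<bullet> x \<noteq> c"
  shows "(\<forall>x\<in>C. n \<bullet> x > c) \<or> (\<forall>x\<in>C. n \<bullet> x < c)"
proof (rule ccontr)
  assume "\<not> ?thesis"
  then obtain x y where "x \<in> C" "n \<bullet> x \<le> c" "y \<in> C" "c \<le> n \<bullet> y"
    by (meson not_less)
  then show False using connected_ivt_hyperplane[OF assms(1)] assms(2) by blast
qed

text \<open>The reflection of \<open>x\<close> in \<open>p\<close> stays in \<open>L\<close>, and
  would violate the inequality if \<open>x\<close> were strictly inside the half-space.\<close>

lemma affine_in_closed_halfspace:
  assumes "affine L" "p \<in> L" "n \<bullet> p = c" "\<forall>x\<in>L. n \<bullet> x \<ge> c" "x \<in> L"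
  shows "n \<bullet> x = c"
proof -
  have "2 *\<^sub>R p + (-1) *\<^sub>R x \<in> L"
    by (rule mem_affine[OF assms(1,2,5)]) simp
  then have "n \<bullet> (2 *\<^sub>R p + (-1) *\<^sub>R x) \<ge> c" using assms(4) by blast
  moreover have "n \<bullet> x \<ge> c" using assms(4,5) by blast
  ultimately show ?thesis using assms(3) by (simp add: inner_diff_right)
qed

text \<open>Trades components for signs. Each component is connected, hence strictly on one side of
  the hyperplane; if both were on the same side, \<open>L\<close> would lie in a closed half-space
  and so in the hyperplane itself.\<close>

lemma separates_in_functional:
  fixes A B :: "(real ^ 'n) set"
  assumes "separates_in L P A B" "P \<noteq> {}" "A \<inter> B = {}"
  obtains n c where "\<And>x. x \<in> L \<Longrightarrow> n \<bullet> x = c \<Longrightarrow> x \<in> P"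
    "\<And>x. x \<in> L \<inter> A \<Longrightarrow> n \<bullet> x \<ge> c" "\<And>x. x \<in> L \<inter> B \<Longrightarrow> n \<bullet> x \<le> c"
proof -
  obtain R Q where L: "affine L" "hyperplane_in L P"
    and comp: "R \<in> components (L - P)" "Q \<in> components (L - P)"
    and un: "R \<union> Q = L - P"
    and col: "R \<inter> (A \<union> B) \<subseteq> A" "Q \<inter> (A \<union> B) \<subseteq> B"
    using assms(1) unfolding separates_in_def by blast
  obtain n c where P: "P = L \<inter> {x. n \<bullet> x = c}"
    using hyperplane_in_eq_Int[OF L assms(2)] by blast
  have sides: "(\<forall>x\<in>C. n \<bullet> x > c) \<or> (\<forall>x\<in>C. n \<bullet> x < c)" if "C \<in> components (L - P)" for C
    using that connected_avoiding_hyperplane[of C n c] P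
      in_components_connected[OF that] in_components_subset[OF that] by blast
  obtain p where p: "p \<in> L" "n \<bullet> p = c" using P assms(2) by blast
  have "R \<noteq> {}" using comp(1) by (simp add: in_components_nonempty)
  then obtain r where r: "r \<in> R" "r \<in> L" "n \<bullet> r \<noteq> c" using un P by blast
  have not_pos: "\<not> ((\<forall>x\<in>R. n \<bullet> x > c) \<and> (\<forall>x\<in>Q. n \<bullet> x > c))"
  proof
    assume "(\<forall>x\<in>R. n \<bullet> x > c) \<and> (\<forall>x\<in>Q. n \<bullet> x > c)"
    then have "\<forall>x\<in>L. n \<bullet> x \<ge> c" using un P by fastforce
    then show False using affine_in_closed_halfspace[OF L(1) p] r by blast
  qed
  have not_neg: "\<not> ((\<forall>x\<in>R. n \<bullet> x < c) \<and> (\<forall>x\<in>Q. n \<bullet> x < c))"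
  proof
    assume "(\<forall>x\<in>R. n \<bullet> x < c) \<and> (\<forall>x\<in>Q. n \<bullet> x < c)"
    then have "\<forall>x\<in>L. (-n) \<bullet> x \<ge> -c" using un P by fastforce
    then show False using affine_in_closed_halfspace[OF L(1) p(1), of "-n" "-c" r] p r by simp
  qed
  have split: "x \<in> P \<or> x \<in> R \<or> x \<in> Q" if "x \<in> L" for x using that un by blast
  have A: "x \<in> P \<or> x \<in> R" if "x \<in> L \<inter> A" for x using split[of x] that col assms(3) by blast
  have B: "x \<in> P \<or> x \<in> Q" if "x \<in> L \<inter> B" for x using split[of x] that col assms(3) by blast
  consider "\<forall>x\<in>R. n \<bullet> x > c" "\<forall>x\<in>Q. n \<bullet> x < c" | "\<forall>x\<in>R. n \<bullet> x < c" "\<forall>x\<in>Q. n \<bullet> x > c"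
    using sides[OF comp(1)] sides[OF comp(2)] not_pos not_neg by blast
  then show thesis
  proof cases
    case 1
    show thesis
      by (rule that[of n c]) (use 1 A B P in \<open>force+\<close>)
  next
    case 2
    show thesis
      by (rule that[of "-n" "-c"]) (use 2 A B P in \<open>force+\<close>)
  qed
qed

lemma condition_H_imp_parallelogram_condition:
  fixes A B :: "(real ^ 'n) set"
  assumes "condition_H A B" "A \<inter> B = {}"
  shows "parallelogram_condition m A B"
  unfolding parallelogram_condition_def
proof (intro ballI allI impI notI)
  fix l and a b :: "nat \<Rightarrow> real ^ 'n"
  assume l: "l \<in> {1..m}" and ab: "(\<forall>i\<in>{1..l}. a i \<in> A) \<and> (\<forall>i\<in>{1..l}. b i \<in> B)"
    and eq: "(\<Sum>i = 1..l. a i) = (\<Sum>i = 1..l. b i)"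
  obtain k H where k: "k \<le> CARD('n)"
    and aff: "\<forall>i \<in> {k..CARD('n)}. affine (H i) \<and> aff_dim (H i) = int i"
    and top: "H CARD('n) = (UNIV :: (real ^ 'n) set)"
    and bot: "H k \<inter> (A \<union> B) \<subseteq> A \<or> H k \<inter> (A \<union> B) \<subseteq> B"
    and sep: "\<forall>i \<in> {k + 1..CARD('n)}. separates_in (H i) (H (i - 1)) A B"
    using assms(1) unfolding condition_H_def by blast
  \<comment> \<open>Downward induction along the flag, starting from the whole space.\<close>
  have "\<forall>j\<in>{1..l}. a j \<in> H k \<and> b j \<in> H k"
    using k
  proof (induction rule: inc_induct)
    case base
    then show ?case by (simp add: top)
  next
    case (step i)
    have "aff_dim (H i) = int i" using aff step by simp
    then have ne: "H i \<noteq> {}" by auto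
    have "separates_in (H (Suc i)) (H i) A B" using bspec[OF sep, of "Suc i"] step by simp
    then obtain n c where nc: "\<And>x. x \<in> H (Suc i) \<Longrightarrow> n \<bullet> x = c \<Longrightarrow> x \<in> H i"
      "\<And>x. x \<in> H (Suc i) \<inter> A \<Longrightarrow> n \<bullet> x \<ge> c" "\<And>x. x \<in> H (Suc i) \<inter> B \<Longrightarrow> n \<bullet> x \<le> c"
      using separates_in_functional[OF _ ne assms(2)] by metis
    have a: "n \<bullet> a j - c \<ge> 0" and b: "c - n \<bullet> b j \<ge> 0" if "j \<in> {1..l}" for j
      using nc(2)[of "a j"] nc(3)[of "b j"] that step.IH ab by auto
    \<comment> \<open>Nonnegative slacks with total zero all vanish, so every point lies on the
      hyperplane.\<close>
    have "(\<Sum>j = 1..l. (n \<bullet> a j - c) + (c - n \<bullet> b j)) = n \<bullet> (\<Sum>j = 1..l. a j) - n \<bullet> (\<Sum>j = 1..l. b j)"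
      by (simp add: inner_sum_right sum_subtractf)
    also have "\<dots> = 0" using eq by simp
    finally have "\<forall>j\<in>{1..l}. (n \<bullet> a j - c) + (c - n \<bullet> b j) = 0"
      using sum_nonneg_eq_0_iff[of "{1..l}" "\<lambda>j. (n \<bullet> a j - c) + (c - n \<bullet> b j)"] a b
      by (metis (no_types, lifting) add_nonneg_nonneg finite_atLeastAtMost)
    then have "n \<bullet> a j = c \<and> n \<bullet> b j = c" if "j \<in> {1..l}" for j
      using a[OF that] b[OF that] that by fastforce
    then show ?case using nc(1) step.IH by blast
  qed
  then have "a 1 \<in> H k \<inter> A" "b 1 \<in> H k \<inter> B" using l ab by auto
  then show False using bot assms(2) by blast
qed

section \<open>Disjoint convex hulls imply separation by a flag\<close>

text \<open>Maximality holds because a connected set avoiding the hyperplane cannot change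
  sides.\<close>

lemma halfspace_gt_component:
  fixes n :: "'a :: euclidean_space"
  assumes "n \<noteq> 0"
  shows "{x. n \<bullet> x > c} \<in> components (UNIV - {x. n \<bullet> x = c})"
  unfolding in_components_maximal
proof (intro conjI allI impI)
  have "n \<bullet> (((c + 1) / (n \<bullet> n)) *\<^sub>R n) > c" using assms by simp
  then show ne: "{x. n \<bullet> x > c} \<noteq> {}" by blast
  show "connected {x. n \<bullet> x > c}" by (simp add: convex_connected convex_halfspace_gt)
  show "D = {x. n \<bullet> x > c}"
    if D: "D \<noteq> {} \<and> {x. n \<bullet> x > c} \<subseteq> D \<and> D \<subseteq> UNIV - {x. n \<bullet> x = c} \<and> connected D" for D
    using connected_avoiding_hyperplane[of D n c] D ne by fastforce
qed auto

lemma condition_H_if_convex_hulls_disjoint: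
  fixes A B :: "(real ^ 'n) set"
  assumes "finite A" "finite B" "A \<noteq> {}" "B \<noteq> {}"
    and "convex hull A \<inter> convex hull B = {}"
  shows "condition_H A B"
proof -
  obtain n c where nc: "\<forall>x\<in>convex hull A. n \<bullet> x < c" "\<forall>x\<in>convex hull B. n \<bullet> x > c"
    using separating_hyperplane_closed_compact[of "convex hull A" "convex hull B"] assms
    by (auto simp: finite_imp_compact_convex_hull compact_imp_closed)
  then have A: "\<forall>x\<in>A. n \<bullet> x < c" and B: "\<forall>x\<in>B. n \<bullet> x > c" by (simp_all add: hull_inc)
  have n: "n \<noteq> 0" using A B assms(3,4) by force
  \<comment> \<open>The flag has only the two levels \<open>d\<close> and \<open>Suc d\<close>. The
    strictly separating hyperplane misses \<open>A\<close> and \<open>B\<close>, so the requirement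
    on \<open>H k\<close> with \<open>k = d\<close> is vacuous.\<close>
  define d where "d = CARD('n) - 1"
  have d: "CARD('n) = Suc d" by (simp add: d_def)
  define H where "H = (\<lambda>i. if i = d then {x. n \<bullet> x = c} else UNIV)"
  have "{x. n \<bullet> x < c} \<in> components (UNIV - {x. n \<bullet> x = c})"
    using halfspace_gt_component[of "-n" "-c"] n by simp
  then have "separates_in (UNIV :: (real ^ 'n) set) {x. n \<bullet> x = c} A B"
    unfolding separates_in_def hyperplane_in_def
    using halfspace_gt_component[OF n, of c] A B n
    by (intro conjI exI[of _ "{x. n \<bullet> x < c}"] exI[of _ "{x. n \<bullet> x > c}"])
      (force simp: affine_hyperplane)+
  moreover have "{x. n \<bullet> x = c} \<inter> (A \<union> B) = {}" using A B by force
  ultimately show ?thesis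
    unfolding condition_H_def d using n
    by (intro exI[of _ d] exI[of _ H] conjI)
      (auto simp: H_def affine_hyperplane d le_Suc_eq)
qed

section \<open>Monochromatic segments do not meet\<close>

text \<open>Symmetric in the two colours, so that results transfer through \<open>swap\<close>. Of
  integral convexity it records only that the hull has no lattice points outside the set.\<close>

locale parallelogram_free =
  fixes A B :: "(real ^ 'n) set"
  assumes fin: "finite A" "finite B"
    and lattice: "A \<union> B \<subseteq> int_lattice"
    and hole_free: "convex hull (A \<union> B) \<inter> int_lattice \<subseteq> A \<union> B"
    and no_parallelogram: "a \<in> A \<Longrightarrow> a' \<in> A \<Longrightarrow> b \<in> B \<Longrightarrow> b' \<in> B \<Longrightarrow> a + a' \<noteq> b + b'"
begin

lemma swap: "parallelogram_free B A"
proof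
  show "B \<union> A \<subseteq> int_lattice" "convex hull (B \<union> A) \<inter> int_lattice \<subseteq> B \<union> A"
    using lattice hole_free by (simp_all add: Un_commute)
  show "b + b' \<noteq> a + a'" if "b \<in> B" "b' \<in> B" "a \<in> A" "a' \<in> A" for a a' b b'
    using no_parallelogram[OF that(3,4,1,2)] by simp
qed (rule fin)+

lemma disjoint: "A \<inter> B = {}"
  using no_parallelogram by fastforce

text \<open>The main source of new points: were \<open>p = b + b' - a\<close> in \<open>A\<close>,
  then \<open>a + p = b + b'\<close> would be forbidden.\<close>

lemma reflect_in:
  assumes "a \<in> A" "b \<in> B" "b' \<in> B" "b + b' - a \<in> convex hull (A \<union> B)"
  shows "b + b' - a \<in> B"
proof -
  have "b + b' - a \<in> int_lattice"
    using assms lattice by (auto simp: int_lattice_def subset_iff intro!: Ints_diff Ints_add)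
  then have "b + b' - a \<in> A \<union> B" using hole_free assms(4) by blast
  moreover have "b + b' - a \<notin> A"
    using no_parallelogram[OF assms(1) _ assms(2,3), of "b + b' - a"] by auto
  ultimately show ?thesis by blast
qed

text \<open>Descent on length: if \<open>a\<close> lies in the half nearer to \<open>b\<close>, its
  mirror image \<open>p\<close> in the midpoint belongs to \<open>B\<close>, and the shorter segment
  from \<open>b\<close> to \<open>p\<close> still contains \<open>a\<close>.\<close>

lemma not_in_segment_nearer:
  assumes IH: "\<And>c c'. c \<in> B \<Longrightarrow> c' \<in> B \<Longrightarrow> dist c c' < dist b b' \<Longrightarrow> a \<notin> closed_segment c c'"
    and "a \<in> A" "b \<in> B" "b' \<in> B" "0 \<le> u" "u \<le> 1/2"
  shows "a \<noteq> (1 - u) *\<^sub>R b + u *\<^sub>R b'"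
proof
  assume a: "a = (1 - u) *\<^sub>R b + u *\<^sub>R b'"
  define p where "p = b + b' - a"
  have p: "p = (1 - (1 - u)) *\<^sub>R b + (1 - u) *\<^sub>R b'" by (simp add: p_def a algebra_simps)
  have "p \<in> closed_segment b b'"
    unfolding in_segment using p assms by (intro exI[of _ "1 - u"]) auto
  then have "p \<in> convex hull (A \<union> B)"
    using assms hull_mono[of "{b, b'}" "A \<union> B" convex] by (auto simp: segment_convex_hull)
  then have pB: "p \<in> B" using reflect_in assms unfolding p_def by blast
  have "a \<noteq> b" using assms disjoint by blast
  then have bb: "b \<noteq> b'" and u: "u \<noteq> 0" using a by (auto simp: algebra_simps)
  have "b - p = (1 - u) *\<^sub>R (b - b')" by (simp add: p algebra_simps)
  then have "dist b p = (1 - u) * dist b b'" using assms by (simp add: dist_norm)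
  then have "dist b p < dist b b'" using u bb assms by simp
  moreover have "a \<in> closed_segment b p"
    unfolding in_segment
  proof (intro exI conjI)
    \<comment> \<open>The position of \<open>a\<close> relative to \<open>b\<close> and
      \<open>p\<close>; the bound by 1 is where \<open>u \<le> 1/2\<close> enters.\<close>
    show "0 \<le> u / (1 - u)" "u / (1 - u) \<le> 1" using assms by simp_all
    define w where "w = u / (1 - u)"
    have w: "w * (1 - u) = u" using assms by (simp add: w_def)
    have "(1 - w) *\<^sub>R b + w *\<^sub>R p = (1 - w * (1 - u)) *\<^sub>R b + (w * (1 - u)) *\<^sub>R b'"
      by (simp add: p algebra_simps)
    then show "a = (1 - u / (1 - u)) *\<^sub>R b + (u / (1 - u)) *\<^sub>R p" by (simp add: a w flip: w_def)
  qed
  ultimately show False using IH assms(3) pB by blast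
qed

lemma not_in_segment:
  assumes "a \<in> A" "b \<in> B" "b' \<in> B"
  shows "a \<notin> closed_segment b b'"
proof
  assume "a \<in> closed_segment b b'"
  \<comment> \<open>Finitely many candidate segments contain \<open>a\<close>, so a shortest one
    exists and plays the role of \<open>IH\<close>.\<close>
  define C where "C = {(b, b') \<in> B \<times> B. a \<in> closed_segment b b'}"
  have "finite C" by (rule finite_subset[of _ "B \<times> B"]) (auto simp: C_def fin)
  moreover have "C \<noteq> {}" using \<open>a \<in> closed_segment b b'\<close> assms by (auto simp: C_def)
  ultimately obtain x where "x \<in> C" and least: "\<forall>y\<in>C. \<not> case_prod dist y < case_prod dist x"
    using ex_is_arg_min_if_finite[of C "case_prod dist"] unfolding is_arg_min_def by blast
  then obtain c c' where x: "x = (c, c')" and c: "c \<in> B" "c' \<in> B" "a \<in> closed_segment c c'"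
    by (auto simp: C_def)
  have IH: "a \<notin> closed_segment e e'" if "e \<in> B" "e' \<in> B" "dist e e' < dist c c'" for e e'
    using least that by (auto simp: C_def x)
  obtain u where u: "0 \<le> u" "u \<le> 1" "a = (1 - u) *\<^sub>R c + u *\<^sub>R c'"
    using c(3) by (auto simp: in_segment)
  show False
  proof (cases "u \<le> 1/2")
    case True
    then show False using not_in_segment_nearer[OF IH] assms(1) c u by blast
  next
    case False
    have "a \<noteq> (1 - (1 - u)) *\<^sub>R c' + (1 - u) *\<^sub>R c"
      by (rule not_in_segment_nearer) (use IH assms(1) c u False in \<open>auto simp: dist_commute\<close>)
    then show False using u by (simp add: add.commute)
  qed
qed

end

section \<open>Crossing segments in the plane\<close>

definition cross2 :: "real ^ 2 \<Rightarrow> real ^ 2 \<Rightarrow> real" where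
  "cross2 u v = u $ 1 * v $ 2 - u $ 2 * v $ 1"

lemma cross2_eq_0:
  assumes "cross2 u v = 0" "u \<noteq> 0"
  obtains k where "v = k *\<^sub>R u"
proof -
  have "u $ 1 \<noteq> 0 \<or> u $ 2 \<noteq> 0" using assms(2) by (auto simp: vec_eq_iff forall_2)
  then show thesis
  proof
    assume "u $ 1 \<noteq> 0"
    then have "v = (v $ 1 / u $ 1) *\<^sub>R u"
      using assms(1) by (simp add: cross2_def vec_eq_iff forall_2 field_simps)
    then show thesis by (rule that)
  next
    assume "u $ 2 \<noteq> 0"
    then have "v = (v $ 2 / u $ 2) *\<^sub>R u"
      using assms(1) by (simp add: cross2_def vec_eq_iff forall_2 field_simps)
    then show thesis by (rule that)
  qed
qed

text \<open>The relative distances of \<open>a\<close>, \<open>a'\<close>, \<open>b\<close>,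
  \<open>b'\<close> from the common point are \<open>1 - s\<close>, \<open>s\<close>,
  \<open>1 - t\<close>, \<open>t\<close>. The bounds say that \<open>a\<close> is relatively nearest
  and \<open>b'\<close> at least as near as \<open>b\<close>; they also give
  \<open>t \<le> s\<close>.\<close>

lemma crossing_reflect:
  fixes a a' b b' :: "'a :: real_vector"
  assumes eq: "s *\<^sub>R a + (1 - s) *\<^sub>R a' = t *\<^sub>R b + (1 - t) *\<^sub>R b'"
    and st: "s \<le> 1" "1 - s \<le> t" "t \<le> 1/2"
  defines "p \<equiv> b + b' - a"
  shows "p \<in> convex hull {b, b', a'}"
    and "closed_segment a a' \<inter> closed_segment p b' \<noteq> {}"
proof -
  \<comment> \<open>Solving the equation for \<open>a\<close> yields the barycentric coordinates of
    \<open>p\<close>.\<close>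
  define r where "r = inverse s"
  have r: "r > 0" "r * s = 1" using st by (auto simp: r_def)
  have "r *\<^sub>R (s *\<^sub>R a + (1 - s) *\<^sub>R a') = r *\<^sub>R (t *\<^sub>R b + (1 - t) *\<^sub>R b')" using eq by simp
  then have "a = (r * t) *\<^sub>R b + (r * (1 - t)) *\<^sub>R b' - (r * (1 - s)) *\<^sub>R a'"
    using r(2) by (simp add: scaleR_add_right algebra_simps)
  then have p: "p = (r * (s - t)) *\<^sub>R b + (r * (s + t - 1)) *\<^sub>R b' + (r * (1 - s)) *\<^sub>R a'"
    using r(2) by (simp add: p_def algebra_simps)
  have "r * (s - t) + r * (s + t - 1) + r * (1 - s) = 1" using r(2) by (simp add: algebra_simps)
  moreover have "r * (s - t) \<ge> 0" "r * (s + t - 1) \<ge> 0" "r * (1 - s) \<ge> 0" using r(1) st by auto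
  ultimately show "p \<in> convex hull {b, b', a'}" using p by (auto simp: convex_hull_3)
next
  \<comment> \<open>Subtracting \<open>t *\<^sub>R a\<close> from both sides leaves total weight
    \<open>1 - t\<close> on each, so rescaling by \<open>w\<close> gives a common point of the new
    segments.\<close>
  define w where "w = inverse (1 - t)"
  have w: "w > 0" "w * (1 - t) = 1" using st by (auto simp: w_def)
  have "(s - t) *\<^sub>R a + (1 - s) *\<^sub>R a' = t *\<^sub>R p + (1 - 2 * t) *\<^sub>R b'"
  proof -
    have "(s - t) *\<^sub>R a + (1 - s) *\<^sub>R a' = (s *\<^sub>R a + (1 - s) *\<^sub>R a') - t *\<^sub>R a"
      by (simp add: algebra_simps)
    also have "\<dots> = t *\<^sub>R p + (1 - t) *\<^sub>R b' - t *\<^sub>R b'"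
      unfolding eq p_def by (simp add: algebra_simps)
    also have "\<dots> = t *\<^sub>R p + (1 - 2 * t) *\<^sub>R b'"
      by (simp flip: scaleR_left_diff_distrib add_diff_eq)
    finally show ?thesis .
  qed
  then have "w *\<^sub>R ((s - t) *\<^sub>R a + (1 - s) *\<^sub>R a') = w *\<^sub>R (t *\<^sub>R p + (1 - 2 * t) *\<^sub>R b')" by simp
  then have e: "(w * (s - t)) *\<^sub>R a + (w * (1 - s)) *\<^sub>R a' = (w * t) *\<^sub>R p + (w * (1 - 2 * t)) *\<^sub>R b'"
    by (simp add: scaleR_add_right)
  have "w * (s - t) + w * (1 - s) = 1" "w * t + w * (1 - 2 * t) = 1"
    using w(2) by (simp_all add: algebra_simps)
  moreover have "w * (s - t) \<ge> 0" "w * (1 - s) \<ge> 0" "w * t \<ge> 0" "w * (1 - 2 * t) \<ge> 0"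
    using w(1) st by auto
  ultimately have "(w * (s - t)) *\<^sub>R a + (w * (1 - s)) *\<^sub>R a' \<in> convex hull {a, a'}"
    "(w * (s - t)) *\<^sub>R a + (w * (1 - s)) *\<^sub>R a' \<in> convex hull {p, b'}"
    unfolding convex_hull_2 using e by blast+
  then show "closed_segment a a' \<inter> closed_segment p b' \<noteq> {}"
    unfolding segment_convex_hull by blast
qed

text \<open>For segments that meet, twice the area of the quadrilateral having them as diagonals;
  zero exactly when the directions are linearly dependent.\<close>

definition meet_area :: "real ^ 2 \<Rightarrow> real ^ 2 \<Rightarrow> real ^ 2 \<Rightarrow> real ^ 2 \<Rightarrow> real" where
  "meet_area a a' b b' = \<bar>cross2 (a - a') (b - b')\<bar>"

lemma meet_area_commute:
  "meet_area a' a b b' = meet_area a a' b b'"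
  "meet_area a a' b' b = meet_area a a' b b'"
  "meet_area b b' a a' = meet_area a a' b b'"
  by (simp_all add: meet_area_def cross2_def algebra_simps abs_minus_commute)

text \<open>Reduces the degenerate case to a point on a segment. On the common line, with
  \<open>a\<close> at 0 and \<open>a'\<close> at 1, the parameters of \<open>b\<close> and
  \<open>b'\<close> enclose some \<open>u\<close> in the unit interval; the lower one is either in
  that interval too or negative, and then 0 is enclosed.\<close>

lemma collinear_segments_meet:
  fixes a a' b b' :: "real ^ 2"
  assumes "meet_area a a' b b' = 0" "closed_segment a a' \<inter> closed_segment b b' \<noteq> {}"
  shows "a \<in> closed_segment b b' \<or> b \<in> closed_segment a a' \<or> b' \<in> closed_segment a a'"
proof (cases "a = a'")
  case True
  then show ?thesis using assms(2) by auto
next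
  case False
  obtain k where k: "b - b' = k *\<^sub>R (a - a')"
    using cross2_eq_0[of "a - a'" "b - b'"] assms(1) False by (auto simp: meet_area_def)
  obtain u t where ut: "0 \<le> u" "u \<le> 1" "0 \<le> t" "t \<le> 1"
    "(1 - u) *\<^sub>R a + u *\<^sub>R a' = (1 - t) *\<^sub>R b + t *\<^sub>R b'"
    using assms(2) by (auto simp: in_segment) metis
  define f where "f v = (1 - v) *\<^sub>R a + v *\<^sub>R a'" for v
  have b: "b = f (u - t * k)"
  proof -
    have "b = (1 - u) *\<^sub>R a + u *\<^sub>R a' + t *\<^sub>R (b - b')" using ut(5) by (simp add: algebra_simps)
    then show ?thesis unfolding k by (simp add: f_def algebra_simps)
  qed
  have b': "b' = f (u + (1 - t) * k)"
  proof -
    have "b' = (1 - u) *\<^sub>R a + u *\<^sub>R a' - (1 - t) *\<^sub>R (b - b')" using ut(5) by (simp add: algebra_simps)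
    then show ?thesis unfolding k by (simp add: f_def algebra_simps)
  qed
  have in_seg: "f v \<in> closed_segment a a'" if "0 \<le> v" "v \<le> 1" for v
    using that by (auto simp: in_segment f_def)
  have cover: "a \<in> closed_segment (f v) (f w)" if "v \<le> 0" "0 \<le> w" "v \<noteq> w" for v w
    unfolding in_segment
  proof (intro exI conjI)
    define z where "z = - v / (w - v)"
    have "z * (w - v) = - v" using that by (simp add: z_def)
    then have z: "(1 - z) * v + z * w = 0" by (simp add: algebra_simps)
    show "0 \<le> - v / (w - v)" "- v / (w - v) \<le> 1" using that by (simp_all add: field_simps)
    have "(1 - z) *\<^sub>R f v + z *\<^sub>R f w = f ((1 - z) * v + z * w)"
      by (simp add: f_def algebra_simps)
    also have "\<dots> = a" unfolding z by (simp add: f_def)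
    finally show "a = (1 - (- v / (w - v))) *\<^sub>R f v + (- v / (w - v)) *\<^sub>R f w"
      by (simp add: z_def)
  qed
  define v w where "v = u - t * k" and "w = u + (1 - t) * k"
  show ?thesis
  proof (cases "0 \<le> k")
    case True
    have vw: "v \<le> u" "u \<le> w" using True ut by (simp_all add: v_def w_def)
    then show ?thesis using in_seg[of v] cover[of v w] ut b b'
      unfolding v_def[symmetric] w_def[symmetric] by (cases "0 \<le> v") auto
  next
    case False
    have vw: "w \<le> u" "u \<le> v" using False ut
      by (simp_all add: v_def w_def mult_nonneg_nonpos)
    then show ?thesis using in_seg[of w] cover[of w v] ut b b'
      unfolding v_def[symmetric] w_def[symmetric]
      by (cases "0 \<le> w") (auto simp: closed_segment_commute)
  qed
qed

text \<open>Replacing \<open>b\<close> by the reflected point scales the area by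
  \<open>1 - t\<close>, and \<open>t = 0\<close> would force \<open>a = b'\<close>.\<close>

lemma meet_area_descent:
  fixes A B :: "(real ^ 2) set"
  assumes "parallelogram_free A B"
    and mem: "a \<in> A" "a' \<in> A" "b \<in> B" "b' \<in> B"
    and eq: "s *\<^sub>R a + (1 - s) *\<^sub>R a' = t *\<^sub>R b + (1 - t) *\<^sub>R b'"
    and st: "s \<le> 1" "1 - s \<le> t" "t \<le> 1/2"
    and pos: "meet_area a a' b b' \<noteq> 0"
  shows "\<exists>p\<in>B. closed_segment a a' \<inter> closed_segment p b' \<noteq> {} \<and>
           meet_area a a' p b' < meet_area a a' b b'"
proof (intro bexI conjI)
  interpret parallelogram_free A B by fact
  let ?p = "b + b' - a"
  show "closed_segment a a' \<inter> closed_segment ?p b' \<noteq> {}"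
    using crossing_reflect(2)[OF eq st] .
  have "?p \<in> convex hull (A \<union> B)"
    using crossing_reflect(1)[OF eq st] hull_mono[of "{b, b', a'}" "A \<union> B" convex] mem by blast
  then show "?p \<in> B" using reflect_in mem by blast
  have "t > 0"
  proof (rule ccontr)
    assume "\<not> t > 0"
    then have "t = 0" "s = 1" using st by auto
    then have "a = b'" using eq by simp
    then show False using disjoint mem by blast
  qed
  \<comment> \<open>The second term is parallel to \<open>a - a'\<close> and drops out of the cross
    product.\<close>
  have "?p - b' = (1 - t) *\<^sub>R (b - b') - (1 - s) *\<^sub>R (a - a')"
    using eq by (simp add: algebra_simps)
  then have "cross2 (a - a') (?p - b') = (1 - t) * cross2 (a - a') (b - b')"
    by (simp only: cross2_def vector_minus_component vector_scaleR_component real_scaleR_def)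
      (simp add: algebra_simps)
  then have "meet_area a a' ?p b' = (1 - t) * meet_area a a' b b'"
    using st by (simp add: meet_area_def abs_mult)
  moreover have "meet_area a a' b b' > 0" using pos by (simp add: meet_area_def)
  ultimately show "meet_area a a' ?p b' < meet_area a a' b b'" using \<open>t > 0\<close> by simp
qed

text \<open>Here some endpoint in \<open>A\<close> is relatively nearest; exchanging
  \<open>a\<close> with \<open>a'\<close> and \<open>b\<close> with \<open>b'\<close> gives four
  cases, each in the normal form of \<open>meet_area_descent\<close>.\<close>

lemma meet_area_descent':
  fixes A B :: "(real ^ 2) set"
  assumes pf: "parallelogram_free A B"
    and mem: "a \<in> A" "a' \<in> A" "b \<in> B" "b' \<in> B"
    and eq: "s *\<^sub>R a + (1 - s) *\<^sub>R a' = t *\<^sub>R b + (1 - t) *\<^sub>R b'"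
    and st: "0 \<le> s" "s \<le> 1" "min s (1 - s) \<le> min t (1 - t)"
    and pos: "meet_area a a' b b' \<noteq> 0"
  shows "\<exists>c\<in>B. \<exists>c'\<in>B. closed_segment a a' \<inter> closed_segment c c' \<noteq> {} \<and>
           meet_area a a' c c' < meet_area a a' b b'"
proof -
  have eq1: "s *\<^sub>R a + (1 - s) *\<^sub>R a' = (1 - t) *\<^sub>R b' + (1 - (1 - t)) *\<^sub>R b"
    and eq2: "(1 - s) *\<^sub>R a' + (1 - (1 - s)) *\<^sub>R a = t *\<^sub>R b + (1 - t) *\<^sub>R b'"
    and eq3: "(1 - s) *\<^sub>R a' + (1 - (1 - s)) *\<^sub>R a = (1 - t) *\<^sub>R b' + (1 - (1 - t)) *\<^sub>R b"
    using eq by (simp_all add: add.commute)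
  consider "1 - s \<le> t" "t \<le> 1/2" | "1 - s \<le> 1 - t" "1 - t \<le> 1/2"
    | "1 - (1 - s) \<le> t" "t \<le> 1/2" | "1 - (1 - s) \<le> 1 - t" "1 - t \<le> 1/2"
    using st(3) by linarith
  then show ?thesis
  proof cases
    case 1
    then show ?thesis
      using meet_area_descent[OF pf mem eq] st pos mem by blast
  next
    case 2
    then show ?thesis
      using meet_area_descent[OF pf mem(1,2,4,3) eq1] st pos mem
      by (auto simp: meet_area_commute(2)[of a a' b b'])
  next
    case 3
    then show ?thesis
      using meet_area_descent[OF pf mem(2,1,3,4) eq2] st pos mem
      by (auto simp: meet_area_commute(1)[of a' a] closed_segment_commute[of a' a])
  next
    case 4
    then show ?thesis
      using meet_area_descent[OF pf mem(2,1,4,3) eq3] st pos mem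
      by (auto simp: meet_area_commute(1)[of a' a] meet_area_commute(2)[of a a' b b']
          closed_segment_commute[of a' a])
  qed
qed

text \<open>A meeting quadruple of least area cannot be degenerate, and otherwise the descent
  applies to whichever colour owns the relatively nearest endpoint.\<close>

lemma segments_disjoint:
  fixes A B :: "(real ^ 2) set"
  assumes pf: "parallelogram_free A B"
    and "a \<in> A" "a' \<in> A" "b \<in> B" "b' \<in> B"
  shows "closed_segment a a' \<inter> closed_segment b b' = {}"
proof (rule ccontr)
  interpret parallelogram_free A B by fact
  interpret swap: parallelogram_free B A by (rule swap)
  assume meet: "closed_segment a a' \<inter> closed_segment b b' \<noteq> {}"
  define C where "C = {(a, a', b, b') \<in> A \<times> A \<times> B \<times> B. closed_segment a a' \<inter> closed_segment b b' \<noteq> {}}"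
  define F where "F = (\<lambda>(a, a', b, b'). meet_area a a' b b')"
  have "finite C" by (rule finite_subset[of _ "A \<times> A \<times> B \<times> B"]) (auto simp: C_def fin)
  moreover have "(a, a', b, b') \<in> C" using meet assms by (simp add: C_def)
  then have "C \<noteq> {}" by blast
  ultimately obtain x where "x \<in> C" and least: "\<forall>y\<in>C. \<not> F y < F x"
    using ex_is_arg_min_if_finite[of C F] unfolding is_arg_min_def by blast
  obtain a a' b b' where x: "x = (a, a', b, b')" by (cases x)
  then have mem: "a \<in> A" "a' \<in> A" "b \<in> B" "b' \<in> B"
    and meet: "closed_segment a a' \<inter> closed_segment b b' \<noteq> {}"
    using \<open>x \<in> C\<close> by (simp_all add: C_def)
  have min: "\<not> meet_area c c' e e' < meet_area a a' b b'"
    if "c \<in> A" "c' \<in> A" "e \<in> B" "e' \<in> B" "closed_segment c c' \<inter> closed_segment e e' \<noteq> {}"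
    for c c' e e' using least that by (fastforce simp: C_def F_def x)
  have pos: "meet_area a a' b b' \<noteq> 0"
    using collinear_segments_meet[OF _ meet] not_in_segment swap.not_in_segment mem by blast
  obtain s t where st: "0 \<le> s" "s \<le> 1" "0 \<le> t" "t \<le> 1"
    "(1 - s) *\<^sub>R a + s *\<^sub>R a' = (1 - t) *\<^sub>R b + t *\<^sub>R b'"
    using meet by (auto simp: in_segment) metis
  have eq: "(1 - s) *\<^sub>R a + (1 - (1 - s)) *\<^sub>R a' = (1 - t) *\<^sub>R b + (1 - (1 - t)) *\<^sub>R b'"
    using st(5) by simp
  show False
  proof (cases "min (1 - s) (1 - (1 - s)) \<le> min (1 - t) (1 - (1 - t))")
    case True
    have "0 \<le> 1 - s" "1 - s \<le> 1" using st by simp_all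
    from meet_area_descent'[OF pf mem eq this True pos] show False using min mem by blast
  next
    case False
    then have le: "min (1 - t) (1 - (1 - t)) \<le> min (1 - s) (1 - (1 - s))" by linarith
    have pos': "meet_area b b' a a' \<noteq> 0" using pos by (simp add: meet_area_commute(3)[of a a'])
    obtain c c' where "c \<in> A" "c' \<in> A" "closed_segment b b' \<inter> closed_segment c c' \<noteq> {}"
      "meet_area b b' c c' < meet_area b b' a a'"
      using meet_area_descent'[OF swap mem(3,4,1,2) eq[symmetric] _ _ le pos'] st(3,4) by force
    then show False
      using min[of c c' b b'] mem
      by (simp add: Int_commute meet_area_commute(3)[of c c'] meet_area_commute(3)[of a a'])
  qed
qed

section \<open>Disjointness of the convex hulls\<close>

text \<open>Common points of the hulls of \<open>A\<close> and \<open>B\<close> correspond to representations of \<open>0\<close> as a convex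
  combination of the points \<open>(a, 1)\<close> and \<open>(-b, -1)\<close> in one more dimension.\<close>

lemma caratheodory_two_hulls:
  fixes A B :: "'a :: euclidean_space set"
  assumes "convex hull A \<inter> convex hull B \<noteq> {}"
  obtains A' B' where "A' \<subseteq> A" "B' \<subseteq> B" "finite A'" "finite B'" "card A' + card B' \<le> DIM('a) + 2"
    "convex hull A' \<inter> convex hull B' \<noteq> {}"
proof -
  define U where "U X = X \<times> {1::real}" for X :: "'a set"
  have hullU: "convex hull (U X) = (convex hull X) \<times> {1}" for X
    by (simp add: U_def convex_hull_Times)
  have hullV: "convex hull (uminus ` U X) = uminus ` ((convex hull X) \<times> {1})" for X
    using convex_hull_linear_image[of uminus "U X"] hullU[of X]
    by (simp add: bounded_linear.linear bounded_linear_minus bounded_linear_ident)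
  obtain x where x: "x \<in> convex hull A" "x \<in> convex hull B" using assms by blast
  have "(x, 1) \<in> convex hull (U A \<union> uminus ` U B)" "- (x, 1) \<in> convex hull (U A \<union> uminus ` U B)"
    using x hullU hullV hull_mono[of "U A" "U A \<union> uminus ` U B" convex]
      hull_mono[of "uminus ` U B" "U A \<union> uminus ` U B" convex] by blast+
  \<comment> \<open>A common point \<open>x\<close> makes 0 the midpoint of two lifted
    points.\<close>
  then have "(1/2) *\<^sub>R (x, 1) + (1/2) *\<^sub>R (- (x, 1)) \<in> convex hull (U A \<union> uminus ` U B)"
    by (intro convexD) (auto simp: convex_convex_hull)
  moreover have "(1/2) *\<^sub>R (x, 1) + (1/2) *\<^sub>R (- (x, 1)) = (0 :: 'a \<times> real)"
    by (simp add: zero_prod_def)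
  ultimately have "0 \<in> convex hull (U A \<union> uminus ` U B)" by metis
  then obtain T where T: "finite T" "T \<subseteq> U A \<union> uminus ` U B" "card T \<le> DIM('a \<times> real) + 1"
      "0 \<in> convex hull T"
    unfolding caratheodory[of "U A \<union> uminus ` U B"] by blast
  \<comment> \<open>The sign of the last coordinate tells the colours apart, so no point of
    \<open>T\<close> is counted twice.\<close>
  define A' B' where "A' = {a. (a, 1) \<in> T}" and "B' = {b. (- b, - 1) \<in> T}"
  have T_eq: "T = U A' \<union> uminus ` U B'"
    using T(2) by (force simp: U_def A'_def B'_def)
  have "finite (U A')" "finite (uminus ` U B')" using T(1) T_eq by auto
  then have fin: "finite A'" "finite B'"
    by (auto simp: U_def finite_cartesian_product_iff dest!: finite_imageD)
  have "U A' \<inter> uminus ` U B' = {}" by (auto simp: U_def)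
  then have "card T = card A' + card B'"
    unfolding T_eq using fin
    by (subst card_Un_disjoint) (auto simp: U_def card_image card_cartesian_product)
  then have card: "card A' + card B' \<le> DIM('a) + 2" using T(3) by simp
  have sub: "A' \<subseteq> A" "B' \<subseteq> B" using T(2) by (auto simp: U_def A'_def B'_def)
  have "A' \<noteq> {}"
  proof
    assume "A' = {}"
    then have "0 \<in> uminus ` ((convex hull B') \<times> {1::real})" using T(4) T_eq hullV by (simp add: U_def)
    then show False by (auto simp: zero_prod_def)
  qed
  moreover have "B' \<noteq> {}"
  proof
    assume "B' = {}"
    then have "0 \<in> (convex hull A') \<times> {1::real}" using T(4) T_eq hullU by (simp add: U_def)
    then show False by (auto simp: zero_prod_def)
  qed
  ultimately have "U A' \<noteq> {}" "uminus ` U B' \<noteq> {}" by (auto simp: U_def)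
  then have "convex hull (convex hull (U A') \<union> convex hull (uminus ` U B')) =
      {u *\<^sub>R s + v *\<^sub>R t | u v s t. u \<ge> 0 \<and> v \<ge> 0 \<and> u + v = 1 \<and>
        s \<in> convex hull (U A') \<and> t \<in> convex hull (uminus ` U B')}"
    by (intro convex_hull_union_two) auto
  moreover have "0 \<in> convex hull (convex hull (U A') \<union> convex hull (uminus ` U B'))"
    using T(4) unfolding T_eq by (rule rev_subsetD) (intro hull_mono Un_mono hull_subset)
  ultimately obtain u v s t where uv: "0 \<le> u" "0 \<le> v" "u + v = 1" "s \<in> convex hull (U A')"
      "t \<in> convex hull (uminus ` U B')" "0 = u *\<^sub>R s + v *\<^sub>R t"
    by auto
  then obtain y z where yz: "y \<in> convex hull A'" "s = (y, 1)" "z \<in> convex hull B'" "t = - (z, 1)"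
    unfolding hullU hullV by auto
  \<comment> \<open>The last coordinate balances the weights; the remaining ones then give
    \<open>y = z\<close>.\<close>
  have "u = v" using uv(6) yz by (simp add: zero_prod_def)
  then have "u \<noteq> 0" using uv(3) by auto
  then have "y = z" using uv(6) yz \<open>u = v\<close> by (simp add: zero_prod_def)
  then show thesis using that[OF sub fin card] yz by blast
qed

section \<open>Integral convexity and the triangle case\<close>

lemma integrally_convex_hole_free:
  assumes "integrally_convex S"
  shows "convex hull S \<inter> int_lattice \<subseteq> S"
proof
  fix x assume x: "x \<in> convex hull S \<inter> int_lattice"
  \<comment> \<open>At a lattice point the neighbourhood collapses, so \<open>x\<close> can only be
    represented by itself.\<close>
  have "int_nbhd x \<subseteq> {x}"
  proof
    fix y assume y: "y \<in> int_nbhd x"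
    have "x $ i = y $ i" for i
    proof -
      have "x $ i - y $ i \<in> \<int>" "\<bar>x $ i - y $ i\<bar> < 1"
        using x y by (auto simp: int_nbhd_def int_lattice_def)
      then show ?thesis using Ints_nonzero_abs_less1 by fastforce
    qed
    then show "y \<in> {x}" by (simp add: vec_eq_iff)
  qed
  moreover have "x \<in> convex hull (S \<inter> int_nbhd x)"
    using assms x by (auto simp: integrally_convex_def)
  ultimately have "S \<inter> int_nbhd x \<noteq> {}" by force
  then show "x \<in> S" using \<open>int_nbhd x \<subseteq> {x}\<close> by blast
qed

text \<open>A point slightly off \<open>a\<close> along the axis has only \<open>a\<close> and the
  axis neighbour as candidate lattice points nearby, and \<open>a\<close> alone cannot represent
  it.\<close>

lemma axis_neighbour:
  fixes S :: "(real ^ 'n) set"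
  assumes "integrally_convex S" "a \<in> S" "a \<in> interior (convex hull S)" "\<sigma> \<in> {1, -1}"
  shows "a + axis i \<sigma> \<in> S"
proof (rule ccontr)
  assume notin: "a + axis i \<sigma> \<notin> S"
  obtain e where e: "e > 0" "ball a e \<subseteq> convex hull S"
    using assms(3) by (meson mem_interior)
  \<comment> \<open>Below \<open>e\<close> to stay in the hull, below 1 to leave just two
    candidates.\<close>
  define \<delta> where "\<delta> = min (e / 2) (1 / 2)"
  have \<delta>: "0 < \<delta>" "\<delta> < e" "\<delta> < 1" using e(1) by (auto simp: \<delta>_def)
  define x where "x = a + axis i (\<delta> * \<sigma>)"
  have "dist a x = \<delta>" using assms(4) \<delta>
    by (auto simp: x_def dist_norm norm_eq_sqrt_inner inner_axis power2_eq_square[symmetric])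
  then have "x \<in> convex hull S" using e \<delta> by auto
  then have hull: "x \<in> convex hull (S \<inter> int_nbhd x)"
    using assms(1) by (auto simp: integrally_convex_def)
  have "S \<inter> int_nbhd x \<subseteq> {a}"
  proof
    fix y assume y: "y \<in> S \<inter> int_nbhd x"
    have a: "a \<in> int_lattice" using assms(1,2) by (auto simp: integrally_convex_def)
    have Z: "a $ j - y $ j \<in> \<int>" for j
      using a y by (auto simp: int_nbhd_def int_lattice_def)
    have near: "\<bar>x $ j - y $ j\<bar> < 1" for j using y by (auto simp: int_nbhd_def)
    have other: "a $ j = y $ j" if "j \<noteq> i" for j
      using near[of j] Z[of j] that Ints_nonzero_abs_less1[of "a $ j - y $ j"]
      by (fastforce simp: x_def axis_def)
    have "\<sigma> * (y $ i - a $ i) \<in> \<int>"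
      using Z[of i] assms(4) by (auto intro: Ints_minus[of "a $ i - y $ i", simplified]
          Ints_minus[of "y $ i - a $ i", simplified])
    then obtain m where m: "\<sigma> * (y $ i - a $ i) = of_int m" by (auto elim: Ints_cases)
    have "\<bar>\<delta> - of_int m\<bar> < 1"
      using near[of i] assms(4) by (auto simp: x_def axis_def abs_if split: if_splits simp flip: m)
    then have "m > -1" "m < 2" using \<delta> by linarith+
    then have "m = 0 \<or> m = 1" by auto
    then have "y $ i = a $ i \<or> y $ i = a $ i + \<sigma>" using m assms(4) by auto
    then have "y = a \<or> y = a + axis i \<sigma>"
      using other unfolding vec_eq_iff axis_def by (simp, metis add_cancel_right_right)
    then show "y \<in> {a}" using notin y by auto
  qed
  then have "x = a" using hull hull_mono[of "S \<inter> int_nbhd x" "{a}" convex] by auto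
  then have "axis i (\<delta> * \<sigma>) = 0" by (simp add: x_def)
  then show False using \<delta> assms(4) by (auto simp: axis_eq_0_iff)
qed

lemma ex_arg_max_finite:
  fixes f :: "'a \<Rightarrow> real"
  assumes "finite X" "X \<noteq> {}"
  obtains x where "x \<in> X" "\<And>y. y \<in> X \<Longrightarrow> f y \<le> f x"
proof -
  have "Max (f ` X) \<in> f ` X" using assms by simp
  then obtain x where "x \<in> X" "f x = Max (f ` X)" by auto
  then show thesis using that[of x] assms by simp
qed

lemma not_all_interior:
  fixes A B :: "(real ^ 'n) set"
  assumes pf: "parallelogram_free A B" and ic: "integrally_convex (A \<union> B)" and "A \<noteq> {}"
  shows "\<not> A \<subseteq> interior (convex hull (A \<union> B))"
proof
  interpret parallelogram_free A B by fact
  assume int: "A \<subseteq> interior (convex hull (A \<union> B))"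
  fix i :: 'n
  obtain r where r: "r \<in> A" "\<And>y. y \<in> A \<Longrightarrow> y $ i \<le> r $ i"
    using ex_arg_max_finite[OF fin(1) assms(3), of "\<lambda>y. y $ i"] by blast
  obtain l where l: "l \<in> A" "\<And>y. y \<in> A \<Longrightarrow> - y $ i \<le> - l $ i"
    using ex_arg_max_finite[OF fin(1) assms(3), of "\<lambda>y. - y $ i"] by blast
  have "r + axis i 1 \<in> A \<union> B" "l + axis i (-1) \<in> A \<union> B"
    using axis_neighbour[OF ic] int r(1) l(1) by auto
  \<comment> \<open>Extremality pushes both neighbours into \<open>B\<close>; the opposite shifts
    cancel in their sum, giving a forbidden equality even when \<open>r = l\<close>.\<close>
  moreover have "r + axis i 1 \<notin> A" using r(2)[of "r + axis i 1"] by (auto simp: axis_def)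
  moreover have "l + axis i (-1) \<notin> A" using l(2)[of "l + axis i (-1)"] by (auto simp: axis_def)
  ultimately have "r + axis i 1 \<in> B" "l + axis i (-1) \<in> B" by auto
  then have "r + l \<noteq> (r + axis i 1) + (l + axis i (-1))" using no_parallelogram r(1) l(1) by blast
  then show False by (simp add: vec_eq_iff axis_def if_distrib cong: if_cong)
qed

lemma point_not_in_triangle:
  fixes A B :: "(real ^ 2) set"
  assumes pf: "parallelogram_free A B" and ic: "integrally_convex (A \<union> B)"
    and "a \<in> A" "T \<subseteq> B" "card T = 3"
  shows "a \<notin> convex hull T"
proof
  interpret parallelogram_free A B by fact
  assume a: "a \<in> convex hull T"
  have "finite T" using assms(5) card.infinite by fastforce
  have frontier: "frontier (convex hull T) = \<Union> {convex hull (T - {c}) | c. c \<in> T}"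
    using frontier_of_convex_hull[of T] assms(5) by simp
  have segs: "\<exists>b\<in>B. \<exists>b'\<in>B. closed_segment b b' = convex hull (T - {c})" if "c \<in> T" for c
  proof -
    have "card (T - {c}) = 2" using that assms(5) \<open>finite T\<close> by simp
    then obtain b b' where "T - {c} = {b, b'}" by (meson card_2_iff)
    then have "b \<in> B" "b' \<in> B" "closed_segment b b' = convex hull (T - {c})"
      using assms(4) by (auto simp: segment_convex_hull)
    then show ?thesis by blast
  qed
  have "x \<in> interior (convex hull T)" if "x \<in> A" for x
  proof (rule ccontr)
    assume x: "x \<notin> interior (convex hull T)"
    \<comment> \<open>The frontier consists of edges with both ends in \<open>B\<close>, which no
      segment between points of \<open>A\<close> may touch.\<close>
    have "closed_segment a x \<inter> frontier (convex hull T) \<noteq> {}"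
    proof (cases "x \<in> convex hull T")
      case True
      then have "x \<in> frontier (convex hull T)"
        using x closure_subset by (auto simp: frontier_def)
      then show ?thesis by blast
    next
      case False
      then show ?thesis using a by (intro connected_Int_frontier) auto
    qed
    then obtain c where "c \<in> T" "closed_segment a x \<inter> convex hull (T - {c}) \<noteq> {}"
      unfolding frontier by blast
    then show False using segs segments_disjoint[OF pf assms(3) that] by blast
  qed
  moreover have "interior (convex hull T) \<subseteq> interior (convex hull (A \<union> B))"
    using assms(4) by (intro interior_mono hull_mono) auto
  ultimately show False using not_all_interior[OF pf ic] assms(3) by blast
qed

lemma card_le_2_segment:
  assumes "card X \<le> 2" "finite X" "X \<noteq> {}"
  obtains x y where "x \<in> X" "y \<in> X" "convex hull X = closed_segment x y"
proof -
  have "card X = 1 \<or> card X = 2" using assms by (auto simp: le_Suc_eq numeral_2_eq_2)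
  then consider x where "X = {x}" | x y where "X = {x, y}"
    by (metis card_1_singletonE card_2_iff)
  then show thesis
    by cases (use that in \<open>auto simp: segment_convex_hull\<close>)
qed

lemma convex_hulls_disjoint:
  fixes A B :: "(real ^ 2) set"
  assumes pf: "parallelogram_free A B" and ic: "integrally_convex (A \<union> B)"
  shows "convex hull A \<inter> convex hull B = {}"
proof (rule ccontr)
  interpret parallelogram_free A B by fact
  assume "convex hull A \<inter> convex hull B \<noteq> {}"
  then obtain A' B' where sub: "A' \<subseteq> A" "B' \<subseteq> B" and fin': "finite A'" "finite B'"
    and card: "card A' + card B' \<le> 4" and meet: "convex hull A' \<inter> convex hull B' \<noteq> {}"
    using caratheodory_two_hulls[of A B] by auto
  then have ne: "A' \<noteq> {}" "B' \<noteq> {}" by auto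
  then have "card A' \<ge> 1" "card B' \<ge> 1" using fin' by (simp_all add: Suc_le_eq card_gt_0_iff)
  \<comment> \<open>Nonempty parts with at most four points in all: two segments (possibly single
    points), or a point and a triangle.\<close>
  then have "card A' \<le> 2 \<and> card B' \<le> 2 \<or> card A' = 1 \<and> card B' = 3 \<or> card A' = 3 \<and> card B' = 1"
    using card by linarith
  then consider "card A' \<le> 2" "card B' \<le> 2" | "card A' = 1" "card B' = 3" | "card A' = 3" "card B' = 1"
    by blast
  then show False
  proof cases
    case 1
    obtain a a' where a: "a \<in> A'" "a' \<in> A'" "convex hull A' = closed_segment a a'"
      by (rule card_le_2_segment[OF 1(1) fin'(1) ne(1)])
    obtain b b' where b: "b \<in> B'" "b' \<in> B'" "convex hull B' = closed_segment b b'"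
      by (rule card_le_2_segment[OF 1(2) fin'(2) ne(2)])
    show False
      using meet segments_disjoint[OF pf, of a a' b b'] a b sub by auto
  next
    case 2
    then obtain a where "A' = {a}" using card_1_singletonE by blast
    then show False using point_not_in_triangle[OF pf ic, of a B'] sub meet 2 by auto
  next
    case 3
    then obtain b where "B' = {b}" using card_1_singletonE by blast
    moreover have "integrally_convex (B \<union> A)" using ic by (simp add: Un_commute)
    ultimately show False using point_not_in_triangle[OF swap, of b A'] sub meet 3 by auto
  qed
qed

section \<open>The equivalence in the plane\<close>

lemma parallelogram_condition_2D:
  assumes "parallelogram_condition 2 A B" "a \<in> A" "a' \<in> A" "b \<in> B" "b' \<in> B"
  shows "a + a' \<noteq> b + b'"
proof -
  have "{1..2} = {1, 2 :: nat}" by auto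
  then show ?thesis
    using assms(1)[unfolded parallelogram_condition_def, rule_format, of 2
        "\<lambda>i. if i = 1 then a else a'" "\<lambda>i. if i = 1 then b else b'"] assms(2-)
    by simp
qed

theorem theorem4p1:
  fixes S A B :: "(real ^ 2) set"
  assumes "S \<subseteq> int_lattice"
    and "finite S"
    and "integrally_convex S"
    and "A \<subseteq> S"
    and "B = S - A"
    and "A \<noteq> {}"
    and "B \<noteq> {}"
  shows "condition_H A B \<longleftrightarrow> parallelogram_condition 2 A B"
proof
  assume "condition_H A B"
  then show "parallelogram_condition 2 A B"
    by (rule condition_H_imp_parallelogram_condition) (use assms in auto)
next
  assume P: "parallelogram_condition 2 A B"
  have S: "A \<union> B = S" using assms by auto
  have fin: "finite A" "finite B" using assms finite_subset by auto
  have "parallelogram_free A B"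
    using fin integrally_convex_hole_free[OF assms(3)] assms(1) parallelogram_condition_2D[OF P]
    by unfold_locales (simp_all add: S)
  then have "convex hull A \<inter> convex hull B = {}"
    using convex_hulls_disjoint assms(3) S by blast
  then show "condition_H A B"
    using condition_H_if_convex_hulls_disjoint fin assms(6,7) by blast
qed

end
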